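(* Let $|H\rangle$ be the $n$-qubit hypergraph state of a connected hypergraph on $n$ vertices with maximum hyperedge cardinality $k_{max}$, and let $K_1,\dots,K_n$ be its generalized stabilizer operators. Then $$\tilde W_n=\frac{n2^{k_{max}-1}-2}{2^{k_{max}-1}}\,\mathbb{I}-\sum_{i=1}^n K_i$$ is an entanglement witness for genuine multipartite entanglement detecting $|H\rangle\langle H|$ (that is, $\mathrm{Tr}[\tilde W_n|H\rangle\langle H|]<0$). Its robustness parameter is $\tilde p_n^L=\dfrac{2}{n2^{k_{max}-1}}$, and the number of local measurement settings needed to measure its expectation value is at most $n$.
   Context: Throughout, $n\ge 2$ is the number of qubits, with Hilbert space $(\mathbb{C}^2)^{\otimes n}$, computational basis $|x\rangle$, $x\in\{0,1\}^n$, and $|+\rangle=(|0\rangle+|1\rangle)/\sqrt2$. A hypergraph $H=(V,E)$ of order $n$ has vertex set $V=\{1,\dots,n\}$ and a set $E$ of nonempty subsets of $V$ (hyperedges). It is connected if for every partition of $V$ into two nonempty sets some hyperedge meets both. For a nonempty set $e\subseteq V$, $C^{e}$ is the controlled-$Z$ gate on the qubits in $e$ (identity on the others): the diagonal operator with $C^e|x\rangle=-|x\rangle$ if $x_j=1$ for all $j\in e$, and $C^e|x\rangle=|x\rangle$ otherwise; by convention $C^{\emptyset}=-\mathbb{I}$. The hypergraph state is $|H\rangle=\prod_{e\in E}C^{e}|+\rangle^{\otimes n}$. With $N(i)=\{e\setminus\{i\}: e\in E,\ i\in e\}$, the generalized stabilizer operators are $K_i=\sigma_x^{(i)}\prod_{e\in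 N(i)}C^{e}$, where $\sigma_x^{(i)}$ is the Pauli $x$ matrix on qubit $i$. Let $S_{bi}$ be the convex set of density matrices that are convex combinations of projectors onto pure biseparable states $|\phi^A\rangle|\phi^B\rangle$, where $A,B$ is a bipartition of the qubits into two nonempty sets (different bipartitions allowed in the same combination). A state not in $S_{bi}$ is called completely entangled. A hermitian operator $W$ is an entanglement witness for genuine multipartite entanglement if $\mathrm{Tr}[W\rho]\ge0$ for all $\rho\in S_{bi}$ and $\mathrm{Tr}[W\rho_{ent}]<0$ for some completely entangled density matrix $\rho_{ent}$. The robustness parameter of a witness $W$ relative to $|H\rangle$ is the limit (largest) value $p^L$ such that $\mathrm{Tr}[R_pW]<0$ for all $0\le p<p^L$, where $R_p=p\,\mathbb{I}/2^n+(1-p)|H\rangle\langle H|$, $0\le p\le1$. A local measurement setting is a choice of single-qubit observables $O^{(i)}$, one for each qubit $i$, measured simultaneously; it gives access to the expectation values of all tensor products whose factor on each qubit $i$ is $O^{(i)}$ or the identity. The expectation value of an operator is measured by a collection of settings if the operator is a linear combination of such tensor products, each accessible from one of the settings in the collection. *)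

theory Defs
  imports "HOL-Analysis.Analysis" "HOL-Library.Complex_Order"
begin

text \<open>
  The qubits (equivalently, the vertices of the hypergraph) are the elements of a finite type
  \<open>'n\<close>, so the number of qubits is \<open>CARD('n)\<close>. A bit string \<open>x \<in> {0,1}\<^sup>n\<close> is a function
  \<open>x :: 'n \<Rightarrow> bool\<close>, with \<open>True\<close> for 1. The order on \<^typ>\<open>complex\<close> is that of
  \<^theory>\<open>HOL-Library.Complex_Order\<close>: \<open>0 \<le> z\<close> and \<open>z < 0\<close> include that \<open>z\<close> is real.
\<close>

type_synonym qubit_op = "complex^bool^bool"
type_synonym 'n state = "complex^('n \<Rightarrow> bool)"
type_synonym 'n operator = "complex^('n \<Rightarrow> bool)^('n \<Rightarrow> bool)"


subsection \<open>Operators and states\<close>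

definition hermitian :: "complex^'a^'a \<Rightarrow> bool" where
  "hermitian A \<longleftrightarrow> (\<forall>x y. A $ x $ y = cnj (A $ y $ x))"

definition pos_semidef :: "complex^'a::finite^'a \<Rightarrow> bool" where
  "pos_semidef A \<longleftrightarrow> hermitian A \<and> (\<forall>v. 0 \<le> (\<Sum>x\<in>UNIV. cnj (v $ x) * (A *v v) $ x))"

definition density_matrix :: "complex^'a::finite^'a \<Rightarrow> bool" where
  "density_matrix \<rho> \<longleftrightarrow> pos_semidef \<rho> \<and> trace \<rho> = 1"

definition projector :: "complex^'a \<Rightarrow> complex^'a^'a" where
  "projector \<psi> = (\<chi> x y. \<psi> $ x * cnj (\<psi> $ y))"

definition tensor_state :: "('n \<Rightarrow> complex^bool) \<Rightarrow> 'n::finite state" where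
  "tensor_state v = (\<chi> x. \<Prod>i\<in>UNIV. v i $ x i)"

definition tensor_op :: "('n \<Rightarrow> qubit_op) \<Rightarrow> 'n::finite operator" where
  "tensor_op A = (\<chi> x y. \<Prod>i\<in>UNIV. A i $ x i $ y i)"

definition single_qubit_op :: "'n \<Rightarrow> qubit_op \<Rightarrow> 'n::finite operator" where
  "single_qubit_op i A = tensor_op (\<lambda>j. if j = i then A else mat 1)"

definition pauli_x :: qubit_op where
  "pauli_x = (\<chi> a b. if a \<noteq> b then 1 else 0)"

definition ket_plus :: "complex^bool" where
  "ket_plus = (1 / complex_of_real (sqrt 2)) *s (axis False 1 + axis True 1)"


subsection \<open>Hypergraphs, hypergraph states and generalized stabilizers\<close>

definition hypergraph :: "'n set set \<Rightarrow> bool" where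
  "hypergraph E \<longleftrightarrow> {} \<notin> E"

definition connected_hypergraph :: "'n set set \<Rightarrow> bool" where
  "connected_hypergraph E \<longleftrightarrow>
     (\<forall>A B. A \<union> B = UNIV \<and> A \<inter> B = {} \<and> A \<noteq> {} \<and> B \<noteq> {} \<longrightarrow>
        (\<exists>e\<in>E. e \<inter> A \<noteq> {} \<and> e \<inter> B \<noteq> {}))"

definition max_edge_card :: "'n set set \<Rightarrow> nat" where
  "max_edge_card E = Max (card ` E)"

text \<open>For \<open>e = {}\<close> this is minus the identity, the convention for \<open>C\<^sup>\<emptyset>\<close>.\<close>

definition CZ :: "'n set \<Rightarrow> 'n::finite operator" where
  "CZ e = (\<chi> x y. if x = y then (if \<forall>j\<in>e. x j then -1 else 1) else 0)"

text \<open>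
  Matrix multiplication is not commutative, so \<^const>\<open>prod\<close> is unavailable; the fold is
  well-defined because the gates \<^const>\<open>CZ\<close> commute with each other.
\<close>

definition CZ_prod :: "'n set set \<Rightarrow> 'n::finite operator" where
  "CZ_prod E = Finite_Set.fold (\<lambda>e M. CZ e ** M) (mat 1) E"

lemma CZ_mult_nth: "(CZ e ** M) $ x $ y = (if \<forall>j\<in>e. x j then -1 else 1) * M $ x $ y"
proof -
  have "(CZ e ** M) $ x $ y =
        (\<Sum>z\<in>UNIV. if z = x then (if \<forall>j\<in>e. x j then -1 else 1) * M $ z $ y else 0)"
    unfolding CZ_def matrix_matrix_mult_def vec_lambda_beta
    by (rule sum.cong) auto
  then show ?thesis by simp
qed

lemma comp_fun_commute_CZ: "comp_fun_commute (\<lambda>e M. CZ e ** M)"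
  by standard (auto simp: fun_eq_iff vec_eq_iff CZ_mult_nth)

lemma CZ_prod_empty [simp]: "CZ_prod {} = mat 1"
  by (simp add: CZ_prod_def)

lemma CZ_prod_insert:
  assumes "e \<notin> E"
  shows "CZ_prod (insert e E) = CZ e ** CZ_prod E"
  unfolding CZ_prod_def
  by (rule comp_fun_commute_on.fold_insert[where S = UNIV])
     (use assms comp_fun_commute_CZ in \<open>auto simp: comp_fun_commute_def'\<close>)

definition hypergraph_state :: "'n set set \<Rightarrow> 'n::finite state" where
  "hypergraph_state E = CZ_prod E *v tensor_state (\<lambda>i. ket_plus)"

definition neighbourhood :: "'n set set \<Rightarrow> 'n \<Rightarrow> 'n set set" where
  "neighbourhood E i = {e - {i} | e. e \<in> E \<and> i \<in> e}"

definition stabilizer_op :: "'n set set \<Rightarrow> 'n \<Rightarrow> 'n::finite operator" where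
  "stabilizer_op E i = single_qubit_op i pauli_x ** CZ_prod (neighbourhood E i)"


subsection \<open>Biseparability, entanglement witnesses and robustness\<close>

text \<open>
  The bit strings indexing the basis of the qubits in \<open>A\<close> are the functions in
  \<open>A \<rightarrow>\<^sub>E UNIV\<close>. The functions \<open>a\<close> and \<open>b\<close> below are the amplitudes of the two normalized
  factors of the state.
\<close>

definition pure_biseparable :: "'n::finite state \<Rightarrow> bool" where
  "pure_biseparable \<psi> \<longleftrightarrow>
     (\<exists>A B a b. A \<union> B = UNIV \<and> A \<inter> B = {} \<and> A \<noteq> {} \<and> B \<noteq> {} \<and>
        (\<Sum>y\<in>A \<rightarrow>\<^sub>E UNIV. (cmod (a y))\<^sup>2) = 1 \<and>
        (\<Sum>z\<in>B \<rightarrow>\<^sub>E UNIV. (cmod (b z))\<^sup>2) = 1 \<and>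
        \<psi> = (\<chi> x. a (restrict x A) * b (restrict x B)))"

definition S_bi :: "('n::finite operator) set" where
  "S_bi = convex hull (projector ` {\<psi>. pure_biseparable \<psi>})"

definition completely_entangled :: "'n::finite operator \<Rightarrow> bool" where
  "completely_entangled \<rho> \<longleftrightarrow> density_matrix \<rho> \<and> \<rho> \<notin> S_bi"

definition entanglement_witness :: "'n::finite operator \<Rightarrow> bool" where
  "entanglement_witness W \<longleftrightarrow>
     hermitian W \<and>
     (\<forall>\<rho>\<in>S_bi. 0 \<le> trace (W ** \<rho>)) \<and>
     (\<exists>\<rho>. completely_entangled \<rho> \<and> trace (W ** \<rho>) < 0)"

definition noisy_state :: "'n::finite state \<Rightarrow> real \<Rightarrow> 'n operator" where
  "noisy_state \<psi> p = (p / 2 ^ CARD('n)) *\<^sub>R mat 1 + (1 - p) *\<^sub>R projector \<psi>"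

definition detects_below :: "'n::finite operator \<Rightarrow> 'n state \<Rightarrow> real \<Rightarrow> bool" where
  "detects_below W \<psi> q \<longleftrightarrow>
     0 \<le> q \<and> q \<le> 1 \<and> (\<forall>p. 0 \<le> p \<and> p < q \<longrightarrow> trace (noisy_state \<psi> p ** W) < 0)"

definition is_robustness_parameter :: "'n::finite operator \<Rightarrow> 'n state \<Rightarrow> real \<Rightarrow> bool" where
  "is_robustness_parameter W \<psi> q \<longleftrightarrow>
     detects_below W \<psi> q \<and> (\<forall>q'. detects_below W \<psi> q' \<longrightarrow> q' \<le> q)"


subsection \<open>Local measurement settings\<close>

definition measurement_setting :: "('n \<Rightarrow> qubit_op) \<Rightarrow> bool" where
  "measurement_setting M \<longleftrightarrow> (\<forall>i. hermitian (M i))"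

definition setting_product :: "('n \<Rightarrow> qubit_op) \<Rightarrow> 'n set \<Rightarrow> 'n::finite operator" where
  "setting_product M A = tensor_op (\<lambda>i. if i \<in> A then M i else mat 1)"

text \<open>
  There is no library notion of scaling a complex matrix by a complex scalar, hence
  \<^const>\<open>map_matrix\<close>.
\<close>

definition measured_by :: "('n::finite \<Rightarrow> qubit_op) set \<Rightarrow> 'n operator \<Rightarrow> bool" where
  "measured_by \<M> W \<longleftrightarrow>
     finite \<M> \<and> (\<forall>M\<in>\<M>. measurement_setting M) \<and>
     (\<exists>c. W = (\<Sum>M\<in>\<M>. \<Sum>A\<in>UNIV. map_matrix (\<lambda>z. c M A * z) (setting_product M A)))"


subsection \<open>The stabilizer witness\<close>

definition stabilizer_witness :: "'n set set \<Rightarrow> 'n::finite operator" where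
  "stabilizer_witness E =
     ((real CARD('n) * 2 ^ (max_edge_card E - 1) - 2) / 2 ^ (max_edge_card E - 1)) *\<^sub>R mat 1
     - (\<Sum>i\<in>UNIV. stabilizer_op E i)"

end

theory Submission
  imports Defs
begin

text \<open>
  Conjugation by the diagonal signs of the hypergraph turns each stabilizer \<open>K\<^sub>i\<close> into the flip of
  qubit \<open>i\<close> and \<open>|H\<rangle>\<close> into the uniform state. The Poincare inequality of the Boolean cube
  then gives \<open>\<Sum>\<^sub>i K\<^sub>i \<le> (n - 2) I + 2 |H\<rangle>\<langle>H|\<close>, so it suffices that \<open>|H\<rangle>\<close> has squared overlap at most
  \<open>1 - 2\<^bsup>1-k\<^esup>\<close> with every biseparable state, \<open>k\<close> being the maximal edge size. Let \<open>i\<close> and \<open>j\<close> lie in a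
  common edge but on different sides of the bipartition. Cut the sign matrix into the \<open>2 \<times> 2\<close> blocks
  in which only qubits \<open>i\<close> and \<open>j\<close> vary. Every block has squared norm at most 4, and at most 2 if it
  contains an odd number of minus signs; the odd blocks are the points where a nonzero polynomial over
  the field with two elements, of degree at most \<open>k - 2\<close> in the other \<open>n - 2\<close> qubits, takes the
  value 1, so there are at least \<open>2\<^bsup>n-k\<^esup>\<close> of them.
\<close>

subsection \<open>Signs of hypergraphs on the Boolean cube\<close>

text \<open>In other terms \<open>(-1)^p(x)\<close>, where \<open>p\<close> is the polynomial over
  the field with two elements whose monomials are the members of \<open>E\<close>; an empty member
  contributes the constant 1.\<close>

definition phase :: "'n set set \<Rightarrow> ('n::finite \<Rightarrow> bool) \<Rightarrow> complex" where
  "phase E x = (\<Prod>e\<in>E. if \<forall>j\<in>e. x j then -1 else 1)"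

definition flip :: "'n \<Rightarrow> ('n \<Rightarrow> bool) \<Rightarrow> 'n \<Rightarrow> bool" where
  "flip i x = x(i := \<not> x i)"

lemma flip_flip [simp]: "flip i (flip i x) = x"
  by (auto simp: flip_def)

lemma flip_commute: "flip i (flip j x) = flip j (flip i x)"
  by (auto simp: flip_def fun_eq_iff)

lemma flip_neq [simp]: "flip i x \<noteq> x" "x \<noteq> flip i x"
  by (auto simp: flip_def fun_eq_iff)

lemma sum_flip: "(\<Sum>x\<in>UNIV. f (flip i x)) = (\<Sum>x\<in>UNIV. f (x :: 'n::finite \<Rightarrow> bool))"
  by (rule sum.reindex_bij_witness[of _ "flip i" "flip i"]) auto

lemma phase_cases: "phase E x = 1 \<or> phase E x = -1"
proof -
  have "finite E \<Longrightarrow> phase E x = 1 \<or> phase E x = -1"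
    by (induction E rule: finite_induct) (auto simp: phase_def)
  then show ?thesis by simp
qed

lemma phase_square [simp]: "phase E x * phase E x = 1" "phase E x * (phase E x * z) = z"
  using phase_cases[of E x] by auto

lemma cnj_phase [simp]: "cnj (phase E x) = phase E x"
  using phase_cases[of E x] by auto

lemma cmod_phase [simp]: "cmod (phase E x) = 1"
  using phase_cases[of E x] by auto

lemma neighbourhood_image: "neighbourhood E i = (\<lambda>e. e - {i}) ` {e \<in> E. i \<in> e}"
  by (auto simp: neighbourhood_def)

text \<open>A discrete derivative in direction \<open>i\<close>: members avoiding \<open>i\<close>
  have equal signs at \<open>x\<close> and \<open>flip i x\<close> and cancel, while a member
  \<open>e\<close> through \<open>i\<close> gives -1 at exactly one of the two points precisely when
  \<open>e - {i}\<close> is fully occupied.\<close>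

lemma phase_neighbourhood: "phase (neighbourhood E i) x = phase E x * phase E (flip i x)"
proof -
  let ?s = "\<lambda>x e. if \<forall>j\<in>e. x j then -1 else (1::complex)"
  let ?I = "{e \<in> E. i \<in> e}"
  have split: "phase E y = prod (?s y) ?I * prod (?s y) {e \<in> E. i \<notin> e}" for y
  proof -
    have "E = ?I \<union> {e \<in> E. i \<notin> e}" by auto
    then show ?thesis
      unfolding phase_def by (subst prod.union_disjoint[symmetric]) auto
  qed
  have rest: "prod (?s (flip i x)) {e \<in> E. i \<notin> e} = prod (?s x) {e \<in> E. i \<notin> e}"
    by (intro prod.cong refl) (auto simp: flip_def)
  have sq: "prod (?s x) {e \<in> E. i \<notin> e} * prod (?s x) {e \<in> E. i \<notin> e} = 1"
    unfolding prod.distrib[symmetric] by (intro prod.neutral) auto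
  have "inj_on (\<lambda>e. e - {i}) ?I"
    by (auto simp: inj_on_def)
  then have "phase (neighbourhood E i) x = (\<Prod>e\<in>?I. ?s x (e - {i}))"
    by (simp add: phase_def neighbourhood_image prod.reindex)
  also have "\<dots> = (\<Prod>e\<in>?I. ?s x e * ?s (flip i x) e)"
  proof (intro prod.cong refl)
    fix e assume "e \<in> ?I"
    then have e: "(\<forall>j\<in>e. y j) \<longleftrightarrow> y i \<and> (\<forall>j\<in>e - {i}. y j)" for y :: "'a \<Rightarrow> bool"
      by auto
    show "?s x (e - {i}) = ?s x e * ?s (flip i x) e"
      unfolding e by (auto simp: flip_def)
  qed
  also have "\<dots> = phase E x * phase E (flip i x)"
    using sq unfolding split rest prod.distrib by (simp add: mult.assoc mult.left_commute)
  finally show ?thesis .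
qed

text \<open>The minimum distance of Reed--Muller codes, by induction on the degree: differentiating in
  a direction \<open>i\<close> replaces the polynomial by that of the neighbourhood of \<open>i\<close>.\<close>

lemma card_phase_neg:
  fixes F :: "'n::finite set set"
  assumes "F \<noteq> {}" "\<And>f. f \<in> F \<Longrightarrow> card f \<le> d"
  shows "2 ^ CARD('n) \<le> 2 ^ d * card {x. phase F x = -1}"
  using assms
proof (induction d arbitrary: F)
  case 0
  then have "F = {{}}" by auto
  then have "{x. phase F x = -1} = UNIV" by (auto simp: phase_def)
  then show ?case by (simp add: card_fun)
next
  case (Suc d)
  show ?case
  proof (cases "F = {{}}")
    case True
    then have "{x. phase F x = -1} = UNIV" by (auto simp: phase_def)
    then show ?thesis by (simp add: card_fun)
  next
    case False
    then obtain f i where f: "f \<in> F" "i \<in> f" using Suc.prems by fastforce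
    let ?O = "{x. phase F x = -1}"
    let ?G = "neighbourhood F i"
    have "2 ^ CARD('n) \<le> 2 ^ d * card {x. phase ?G x = -1}"
    proof (rule Suc.IH)
      show "?G \<noteq> {}" using f by (auto simp: neighbourhood_def)
      show "card g \<le> d" if g: "g \<in> ?G" for g
      proof -
        obtain e where "e \<in> F" "i \<in> e" "g = e - {i}" using g by (auto simp: neighbourhood_def)
        then show ?thesis using Suc.prems(2)[of e] by simp
      qed
    qed
    \<comment> \<open>A product of two signs is -1 only if one of them is, so \<open>?O\<close> and
      its flip cover the odd points of the derivative. The factor 2 lost here pays for the drop in
      degree.\<close>
    also have "card {x. phase ?G x = -1} \<le> card (?O \<union> flip i ` ?O)"
    proof (rule card_mono)
      show "{x. phase ?G x = -1} \<subseteq> ?O \<union> flip i ` ?O"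
      proof
        fix x assume "x \<in> {x. phase ?G x = -1}"
        then have "phase F x * phase F (flip i x) = -1" by (simp add: phase_neighbourhood)
        then have "phase F x = -1 \<or> phase F (flip i x) = -1"
          using phase_cases[of F x] by auto
        then show "x \<in> ?O \<union> flip i ` ?O"
          using image_eqI[of x "flip i" "flip i x" ?O] by auto
      qed
    qed simp
    also have "\<dots> \<le> card ?O + card (flip i ` ?O)" by (rule card_Un_le)
    also have "\<dots> \<le> 2 * card ?O" using card_image_le[of ?O "flip i"] by simp
    finally show ?thesis by simp
  qed
qed


subsection \<open>The Poincare inequality on the cube\<close>

lemma cmod_parallelogram: "(cmod (p + q))\<^sup>2 + (cmod (p - q))\<^sup>2 = 2 * (cmod p)\<^sup>2 + 2 * (cmod q)\<^sup>2"
  unfolding cmod_power2 by (simp add: power2_eq_square algebra_simps)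

definition avg :: "'n \<Rightarrow> (('n \<Rightarrow> bool) \<Rightarrow> complex) \<Rightarrow> ('n \<Rightarrow> bool) \<Rightarrow> complex" where
  "avg i f x = (f x + f (flip i x)) / 2"

definition energy :: "'n::finite \<Rightarrow> (('n \<Rightarrow> bool) \<Rightarrow> complex) \<Rightarrow> real" where
  "energy i f = (\<Sum>x\<in>UNIV. (cmod (f x - f (flip i x)))\<^sup>2)"

lemma sum_cmod_avg:
  "(\<Sum>x\<in>UNIV. (cmod (avg i f x))\<^sup>2) + energy i f / 4 = (\<Sum>x\<in>UNIV. (cmod (f x))\<^sup>2)"
proof -
  have "4 * (cmod (avg i f x))\<^sup>2 + (cmod (f x - f (flip i x)))\<^sup>2
          = 2 * (cmod (f x))\<^sup>2 + 2 * (cmod (f (flip i x)))\<^sup>2" for x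
    using cmod_parallelogram[of "f x" "f (flip i x)"]
    by (simp add: avg_def norm_divide power_divide)
  then have "(\<Sum>x\<in>UNIV. 4 * (cmod (avg i f x))\<^sup>2 + (cmod (f x - f (flip i x)))\<^sup>2)
      = (\<Sum>x\<in>UNIV. 2 * (cmod (f x))\<^sup>2 + 2 * (cmod (f (flip i x)))\<^sup>2)"
    by simp
  then show ?thesis
    using sum_flip[of "\<lambda>x. (cmod (f x))\<^sup>2" i]
    by (simp add: sum.distrib energy_def flip: sum_distrib_left)
qed

text \<open>Averaging in direction \<open>i\<close> commutes with taking differences in direction
  \<open>j\<close>, and it is a contraction by \<open>sum_cmod_avg\<close>.\<close>

lemma energy_avg_le: "energy j (avg i f) \<le> energy j f"
proof -
  let ?d = "\<lambda>x. f x - f (flip j x)"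
  have "avg i f x - avg i f (flip j x) = avg i ?d x" for x
    by (simp add: avg_def flip_commute[of i j] field_simps)
  then have "energy j (avg i f) = (\<Sum>x\<in>UNIV. (cmod (avg i ?d x))\<^sup>2)"
    by (simp add: energy_def)
  also have "\<dots> \<le> (\<Sum>x\<in>UNIV. (cmod (?d x))\<^sup>2)"
    using sum_cmod_avg[of i ?d] sum_nonneg[of UNIV "\<lambda>x. (cmod (?d x - ?d (flip i x)))\<^sup>2"]
    by (simp add: energy_def)
  finally show ?thesis by (simp add: energy_def)
qed

lemma sum_avg: "(\<Sum>x\<in>UNIV. avg i f x) = (\<Sum>x\<in>UNIV. f x)" for f :: "('n::finite \<Rightarrow> bool) \<Rightarrow> complex"
  using sum_flip[of f i] by (simp add: avg_def sum.distrib flip: sum_divide_distrib)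

lemma constant_if_flip_invariant:
  fixes f :: "('n::finite \<Rightarrow> bool) \<Rightarrow> 'b"
  assumes "\<And>i x. f (flip i x) = f x"
  shows "f x = f y"
proof -
  have "finite S \<Longrightarrow> f (\<lambda>i. if i \<in> S then \<not> x i else x i) = f x" for S
  proof (induction S rule: finite_induct)
    case (insert i S)
    have "(\<lambda>k. if k \<in> insert i S then \<not> x k else x k) = flip i (\<lambda>k. if k \<in> S then \<not> x k else x k)"
      using insert by (auto simp: flip_def fun_eq_iff)
    then show ?case using insert assms by simp
  qed simp
  \<comment> \<open>Flipping exactly the coordinates where the two strings differ leads from
    \<open>x\<close> to \<open>y\<close>.\<close>
  from this[of "{i. x i \<noteq> y i}"] have "f (\<lambda>i. if x i \<noteq> y i then \<not> x i else x i) = f x" by simp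
  also have "(\<lambda>i. if x i \<noteq> y i then \<not> x i else x i) = y" by auto
  finally show ?thesis by simp
qed

text \<open>Martingale argument: averaging over one coordinate after another, each step loses a quarter of
  the energy in that direction, and energies only decrease along the way.\<close>

lemma average_over_coordinates:
  fixes f :: "('n::finite \<Rightarrow> bool) \<Rightarrow> complex"
  shows "finite S \<Longrightarrow> \<exists>g. (\<forall>i\<in>S. \<forall>x. g (flip i x) = g x) \<and>
    (\<Sum>x\<in>UNIV. g x) = (\<Sum>x\<in>UNIV. f x) \<and> (\<forall>i. energy i g \<le> energy i f) \<and>
    (\<Sum>x\<in>UNIV. (cmod (f x))\<^sup>2) - (\<Sum>x\<in>UNIV. (cmod (g x))\<^sup>2) \<le> (\<Sum>i\<in>S. energy i f) / 4"
proof (induction S rule: finite_induct)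
  case empty
  show ?case by (intro exI[of _ f]) simp
next
  case (insert i S)
  then obtain g where inv: "\<And>j x. j \<in> S \<Longrightarrow> g (flip j x) = g x"
    and sums: "(\<Sum>x\<in>UNIV. g x) = (\<Sum>x\<in>UNIV. f x)" and en: "\<And>j. energy j g \<le> energy j f"
    and norms: "(\<Sum>x\<in>UNIV. (cmod (f x))\<^sup>2) - (\<Sum>x\<in>UNIV. (cmod (g x))\<^sup>2) \<le> (\<Sum>i\<in>S. energy i f) / 4"
    by blast
  have "avg i g (flip j x) = avg i g x" if "j \<in> insert i S" for j x
    using that inv by (cases "j = i") (auto simp: avg_def flip_commute[of i j])
  moreover have "energy j (avg i g) \<le> energy j f" for j
    using energy_avg_le[of j i g] en[of j] by simp
  ultimately show ?case
    using insert.hyps sums norms en[of i] sum_cmod_avg[of i g]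
    by (intro exI[of _ "avg i g"]) (auto simp: sum_avg)
qed

text \<open>Averaging over every coordinate leaves a constant function; the preserved sum fixes its
  value, and its squared norm is the subtracted term.\<close>

lemma poincare:
  fixes f :: "('n::finite \<Rightarrow> bool) \<Rightarrow> complex"
  shows "(\<Sum>x\<in>UNIV. (cmod (f x))\<^sup>2) - (cmod (\<Sum>x\<in>UNIV. f x))\<^sup>2 / 2 ^ CARD('n)
           \<le> (\<Sum>i\<in>UNIV. energy i f) / 4"
proof -
  from average_over_coordinates[OF finite[of UNIV], of f] show ?thesis
  proof (elim exE conjE)
    fix g :: "('n \<Rightarrow> bool) \<Rightarrow> complex"
    assume inv: "\<forall>i\<in>UNIV. \<forall>x. g (flip i x) = g x"
      and sums: "(\<Sum>x\<in>UNIV. g x) = (\<Sum>x\<in>UNIV. f x)"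
      and norms: "(\<Sum>x\<in>UNIV. (cmod (f x))\<^sup>2) - (\<Sum>x\<in>UNIV. (cmod (g x))\<^sup>2)
                    \<le> (\<Sum>i\<in>UNIV. energy i f) / 4"
    define c where "c = g (\<lambda>_. False)"
    have g: "g x = c" for x
      unfolding c_def by (rule constant_if_flip_invariant) (use inv in blast)
    have "(cmod (\<Sum>x\<in>UNIV. f x))\<^sup>2 / 2 ^ CARD('n) = (\<Sum>x\<in>UNIV. (cmod (g x))\<^sup>2)"
      unfolding sums[symmetric] g
      by (simp add: card_fun norm_mult norm_power power2_eq_square)
    then show ?thesis using norms by simp
  qed
qed


subsection \<open>Overlap of a connected hypergraph state with biseparable states\<close>

text \<open>Lagrange's identity writes the gap as a square.\<close>

lemma cmod_two_cauchy:
  "(cmod (a * u + b * v))\<^sup>2 \<le> ((cmod a)\<^sup>2 + (cmod b)\<^sup>2) * ((cmod u)\<^sup>2 + (cmod v)\<^sup>2)"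
proof -
  have "((cmod a)\<^sup>2 + (cmod b)\<^sup>2) * ((cmod u)\<^sup>2 + (cmod v)\<^sup>2) - (cmod (a * u + b * v))\<^sup>2
          = (cmod (a * cnj v - b * cnj u))\<^sup>2"
    unfolding cmod_power2 by (simp add: power2_eq_square algebra_simps)
  then show ?thesis by (metis diff_ge_0_iff_ge zero_le_power2)
qed

text \<open>Oddness makes the two rows of signs orthogonal: up to sign, one of \<open>?p\<close>,
  \<open>?q\<close> is \<open>u + v\<close> and the other \<open>u - v\<close>. The parallelogram
  law then improves the constant 4 of \<open>four_cauchy\<close> to 2.\<close>

lemma odd_block_bound:
  assumes s: "s1 = 1 \<or> s1 = -1" "s2 = 1 \<or> s2 = -1" "s3 = 1 \<or> s3 = -1" "s4 = 1 \<or> s4 = -1"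
    and odd: "s1 * s2 * s3 * s4 = (-1 :: complex)"
  shows "(cmod (s1 * (a * u) + s2 * (b * u) + s3 * (a * v) + s4 * (b * v)))\<^sup>2
    \<le> 2 * ((cmod (a * u))\<^sup>2 + (cmod (b * u))\<^sup>2 + (cmod (a * v))\<^sup>2 + (cmod (b * v))\<^sup>2)"
proof -
  let ?p = "s1 * u + s3 * v" and ?q = "s2 * u + s4 * v"
  have "(cmod ?p)\<^sup>2 + (cmod ?q)\<^sup>2 = 2 * ((cmod u)\<^sup>2 + (cmod v)\<^sup>2)"
    using s odd cmod_parallelogram[of u v]
    by (auto simp: norm_minus_commute[of v u] add.commute[of v u]
        simp flip: norm_minus_cancel[of "- u - v"])
  moreover have "s1 * (a * u) + s2 * (b * u) + s3 * (a * v) + s4 * (b * v) = a * ?p + b * ?q"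
    by (simp add: algebra_simps)
  ultimately show ?thesis
    using cmod_two_cauchy[of a ?p b ?q] by (simp add: norm_mult power_mult_distrib algebra_simps)
qed

lemma four_cauchy:
  "(cmod (p + q + r + s))\<^sup>2 \<le> 4 * ((cmod p)\<^sup>2 + (cmod q)\<^sup>2 + (cmod r)\<^sup>2 + (cmod s)\<^sup>2)"
proof -
  have two: "(cmod (y + z))\<^sup>2 \<le> 2 * (cmod y)\<^sup>2 + 2 * (cmod z)\<^sup>2" for y z
    using cmod_parallelogram[of y z] zero_le_power2[of "cmod (y - z)"] by linarith
  show ?thesis using two[of "p + q" "r + s"] two[of p q] two[of r s] by (simp add: add.assoc)
qed

lemma card_neighbourhood_le:
  fixes E :: "'n::finite set set"
  assumes "f \<in> neighbourhood E i" "\<And>e. e \<in> E \<Longrightarrow> card e \<le> k"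
  shows "card f \<le> k - 1"
proof -
  obtain e where "e \<in> E" "i \<in> e" "f = e - {i}" using assms by (auto simp: neighbourhood_def)
  then show ?thesis using assms(2)[of e] by simp
qed

lemma sum_four_flips:
  fixes h :: "('n::finite \<Rightarrow> bool) \<Rightarrow> 'b::comm_semiring_1"
  shows "(\<Sum>x\<in>UNIV. h x + h (flip i x) + h (flip j x) + h (flip i (flip j x))) = 4 * (\<Sum>x\<in>UNIV. h x)"
proof -
  have "(\<Sum>x\<in>UNIV. h (flip i (flip j x))) = (\<Sum>x\<in>UNIV. h x)"
    using sum_flip[of "\<lambda>x. h (flip i x)" j] sum_flip[of h i] by simp
  moreover have "4 * z = z + z + z + z" for z :: 'b
  proof -
    have "4 = 1 + 1 + 1 + (1 :: 'b)" by simp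
    then show ?thesis by (simp only: distrib_right mult_1)
  qed
  ultimately show ?thesis by (simp add: sum.distrib sum_flip[of h i] sum_flip[of h j])
qed

text \<open>\<open>\<gamma>\<close> is the signed sum over the block through \<open>x\<close>,
  \<open>\<nu>\<close> its squared norm and \<open>c\<close> the constant available for it. Summing
  over all \<open>x\<close> visits each block four times, and Cauchy-Schwarz combines the block
  estimates.\<close>

lemma overlap_bound:
  fixes E :: "'n::finite set set" and \<alpha> \<beta> :: "('n \<Rightarrow> bool) \<Rightarrow> complex"
  assumes e: "e \<in> E" "i \<in> e" "j \<in> e" "i \<noteq> j"
    and k: "\<And>e. e \<in> E \<Longrightarrow> card e \<le> k" "2 \<le> k"
    and \<alpha>: "\<And>x. \<alpha> (flip j x) = \<alpha> x" and \<beta>: "\<And>x. \<beta> (flip i x) = \<beta> x"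
    and norm: "(\<Sum>x\<in>UNIV. (cmod (\<alpha> x * \<beta> x))\<^sup>2) = 1"
  shows "(cmod (\<Sum>x\<in>UNIV. phase E x * (\<alpha> x * \<beta> x)))\<^sup>2 \<le> 2 ^ CARD('n) * (1 - 1 / 2 ^ (k - 1))"
proof -
  \<comment> \<open>The second derivative in directions \<open>i\<close> and \<open>j\<close>: its
    sign is the product of the four signs of a block, hence -1 exactly on odd blocks.\<close>
  define F where "F = neighbourhood (neighbourhood E i) j"
  define \<psi> where "\<psi> x = \<alpha> x * \<beta> x" for x
  define g where "g x = phase E x * \<psi> x" for x
  define \<gamma> where "\<gamma> x = g x + g (flip i x) + g (flip j x) + g (flip i (flip j x))" for x
  define \<nu> where "\<nu> x = (cmod (\<psi> x))\<^sup>2 + (cmod (\<psi> (flip i x)))\<^sup>2 + (cmod (\<psi> (flip j x)))\<^sup>2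
      + (cmod (\<psi> (flip i (flip j x))))\<^sup>2" for x
  define c :: "('n \<Rightarrow> bool) \<Rightarrow> real" where "c x = (if phase F x = -1 then 2 else 4)" for x
  let ?O = "{x. phase F x = -1}"
  have F: "phase F x = phase E x * phase E (flip i x) * (phase E (flip j x) * phase E (flip i (flip j x)))" for x
    by (simp add: F_def phase_neighbourhood)
  \<comment> \<open>The common edge makes \<open>F\<close> nonempty; when \<open>e = {i, j}\<close>,
    it contributes the empty set.\<close>
  have "e - {i} - {j} \<in> F" using e by (auto simp: F_def neighbourhood_def)
  moreover have "card f \<le> k - 2" if "f \<in> F" for f
  proof -
    have "card f \<le> k - 1 - 1"
      using that unfolding F_def
      by (rule card_neighbourhood_le) (erule card_neighbourhood_le, rule k)
    then show ?thesis by simp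
  qed
  ultimately have "2 ^ CARD('n) \<le> 2 ^ (k - 2) * card ?O"
    by (intro card_phase_neg) auto
  then have "real (2 ^ CARD('n)) \<le> real (2 ^ (k - 2) * card ?O)"
    by (simp only: of_nat_le_iff)
  moreover have k1: "2 ^ (k - 1) = 2 * (2::real) ^ (k - 2)"
    using k(2) by (metis One_nat_def Suc_diff_Suc diff_Suc_1 le_imp_less_Suc numeral_2_eq_2
      power_Suc less_eq_Suc_le)
  \<comment> \<open>\<open>?O\<close> counts points, so every odd block enters four times.\<close>
  ultimately have O: "2 ^ CARD('n) / 2 ^ (k - 1) \<le> real (card ?O) / 2"
    by (simp add: field_simps)
  have \<gamma>: "(cmod (\<gamma> x))\<^sup>2 \<le> c x * \<nu> x" for x
  proof (cases "phase F x = -1")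
    case True
    \<comment> \<open>Within a block each factor takes only two values, so the four amplitudes form
      a product array as \<open>odd_block_bound\<close> requires.\<close>
    have "\<alpha> (flip i (flip j x)) = \<alpha> (flip i x)" "\<beta> (flip i (flip j x)) = \<beta> (flip j x)"
      using \<alpha>[of "flip i x"] \<beta>[of "flip j x"] by (simp_all add: flip_commute[of i j])
    then show ?thesis
      using True F[of x] odd_block_bound[OF phase_cases[of E x] phase_cases[of E "flip i x"]
        phase_cases[of E "flip j x"] phase_cases[of E "flip i (flip j x)"],
        of "\<alpha> x" "\<beta> x" "\<alpha> (flip i x)" "\<beta> (flip j x)"]
      by (simp add: c_def \<gamma>_def \<nu>_def g_def \<psi>_def \<alpha> \<beta> mult.assoc)
  next
    case False
    then show ?thesis
      using four_cauchy[of "g x" "g (flip i x)" "g (flip j x)" "g (flip i (flip j x))"]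
      by (simp add: c_def \<gamma>_def \<nu>_def g_def norm_mult)
  qed
  have nn: "0 \<le> c x" "0 \<le> \<nu> x" for x by (auto simp: c_def \<nu>_def)
  have "(cmod (\<Sum>x\<in>UNIV. \<gamma> x))\<^sup>2 \<le> (\<Sum>x\<in>UNIV. sqrt (c x) * sqrt (\<nu> x))\<^sup>2"
  proof (rule power_mono)
    show "cmod (\<Sum>x\<in>UNIV. \<gamma> x) \<le> (\<Sum>x\<in>UNIV. sqrt (c x) * sqrt (\<nu> x))"
      by (rule sum_norm_le) (use \<gamma> in \<open>simp add: real_le_rsqrt flip: real_sqrt_mult\<close>)
  qed simp
  also have "\<dots> \<le> (\<Sum>x\<in>UNIV. (sqrt (c x))\<^sup>2) * (\<Sum>x\<in>UNIV. (sqrt (\<nu> x))\<^sup>2)"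
    by (rule Cauchy_Schwarz_ineq_sum)
  also have "\<dots> = (\<Sum>x\<in>UNIV. c x) * (\<Sum>x\<in>UNIV. \<nu> x)"
    by (simp add: nn)
  also have "(\<Sum>x\<in>UNIV. \<nu> x) = 4"
    unfolding \<nu>_def sum_four_flips[of "\<lambda>x. (cmod (\<psi> x))\<^sup>2"] using norm by (simp add: \<psi>_def)
  also have "(\<Sum>x\<in>UNIV. c x) = 4 * 2 ^ CARD('n) - 2 * real (card ?O)"
  proof -
    have "c x = 4 - 2 * of_bool (x \<in> ?O)" for x by (auto simp: c_def)
    then show ?thesis
      by (simp add: sum_subtractf card_fun of_bool_def sum.If_cases flip: sum_distrib_left)
  qed
  also have "(\<Sum>x\<in>UNIV. \<gamma> x) = 4 * (\<Sum>x\<in>UNIV. g x)"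
    unfolding \<gamma>_def by (rule sum_four_flips)
  finally have "(cmod (\<Sum>x\<in>UNIV. g x))\<^sup>2 \<le> 2 ^ CARD('n) - real (card ?O) / 2"
    by (simp add: norm_mult power_mult_distrib)
  then show ?thesis
    using O by (simp add: g_def \<psi>_def algebra_simps)
qed

text \<open>The amplitudes of the two sides become functions on the whole cube that ignore the other
  side's bits. A string is the same as its pair of restrictions, so the two normalizations
  multiply.\<close>

lemma pure_biseparable_factors:
  fixes \<psi> :: "'n::finite state"
  assumes "pure_biseparable \<psi>"
  obtains A \<alpha> \<beta> where "A \<noteq> {}" "A \<noteq> UNIV" "\<And>x. \<psi> $ x = \<alpha> x * \<beta> x"
    "\<And>j x. j \<notin> A \<Longrightarrow> \<alpha> (flip j x) = \<alpha> x" "\<And>i x. i \<in> A \<Longrightarrow> \<beta> (flip i x) = \<beta> x"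
    "(\<Sum>x\<in>UNIV. (cmod (\<alpha> x * \<beta> x))\<^sup>2) = 1"
proof -
  obtain A B a b where AB: "A \<union> B = UNIV" "A \<inter> B = {}" "A \<noteq> {}" "B \<noteq> {}"
    and a: "(\<Sum>y\<in>A \<rightarrow>\<^sub>E UNIV. (cmod (a y))\<^sup>2) = 1"
    and b: "(\<Sum>z\<in>B \<rightarrow>\<^sub>E UNIV. (cmod (b z))\<^sup>2) = 1"
    and \<psi>: "\<psi> = (\<chi> x. a (restrict x A) * b (restrict x B))"
    using assms unfolding pure_biseparable_def by blast
  have disj: "i \<notin> B" if "i \<in> A" for i
    using that AB by auto
  have "A \<noteq> UNIV" using AB by auto
  have flip: "restrict (flip j x) S = restrict x S" if "j \<notin> S" for j x and S :: "'n set"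
    using that by (auto simp: restrict_def flip_def fun_eq_iff)
  have "(\<Sum>x\<in>UNIV. (cmod (a (restrict x A) * b (restrict x B)))\<^sup>2)
      = (\<Sum>(y, z)\<in>(A \<rightarrow>\<^sub>E UNIV) \<times> (B \<rightarrow>\<^sub>E UNIV). (cmod (a y))\<^sup>2 * (cmod (b z))\<^sup>2)"
  proof (rule sum.reindex_bij_witness[of _ "\<lambda>(y, z) k. if k \<in> A then y k else z k"
        "\<lambda>x. (restrict x A, restrict x B)"], goal_cases)
    case (3 p)
    obtain y z where p: "p = (y, z)" "y \<in> A \<rightarrow>\<^sub>E UNIV" "z \<in> B \<rightarrow>\<^sub>E UNIV"
      using 3 by auto
    have "restrict (\<lambda>k. if k \<in> A then y k else z k) A = y"
      using p by (auto simp: restrict_def fun_eq_iff PiE_def extensional_def)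
    moreover have "restrict (\<lambda>k. if k \<in> A then y k else z k) B = z"
      using p AB by (auto simp: restrict_def fun_eq_iff PiE_def extensional_def)
    ultimately show ?case using p by simp
  qed (use AB in \<open>auto simp: norm_mult power_mult_distrib fun_eq_iff\<close>)
  also have "\<dots> = 1"
    using a b by (simp add: sum.cartesian_product[symmetric] flip: sum_product)
  finally show ?thesis
    using AB(3) flip \<open>A \<noteq> UNIV\<close> disj by (intro that[of A "\<lambda>x. a (restrict x A)" "\<lambda>x. b (restrict x B)"]) (auto simp: \<psi>)
qed

lemma connected_crossing_edge:
  assumes "connected_hypergraph E" "A \<noteq> {}" "A \<noteq> UNIV"
  obtains e i j where "e \<in> E" "i \<in> e" "j \<in> e" "i \<in> A" "j \<notin> A"
proof -
  have "A \<union> - A = UNIV \<and> A \<inter> - A = {} \<and> A \<noteq> {} \<and> - A \<noteq> {}" using assms by auto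
  then have "\<exists>e\<in>E. e \<inter> A \<noteq> {} \<and> e \<inter> - A \<noteq> {}"
    using assms(1) unfolding connected_hypergraph_def by blast
  then show ?thesis using that by blast
qed

lemma card_le_max_edge_card: "e \<in> E \<Longrightarrow> card e \<le> max_edge_card (E :: 'n::finite set set)"
  unfolding max_edge_card_def by (intro Max_ge) auto

lemma biseparable_overlap_bound:
  fixes \<psi> :: "'n::finite state"
  assumes "connected_hypergraph E" "pure_biseparable \<psi>"
  shows "(cmod (\<Sum>x\<in>UNIV. phase E x * \<psi> $ x))\<^sup>2 \<le> 2 ^ CARD('n) * (1 - 1 / 2 ^ (max_edge_card E - 1))"
    and "(\<Sum>x\<in>UNIV. (cmod (\<psi> $ x))\<^sup>2) = 1"
proof -
  obtain A \<alpha> \<beta> where A: "A \<noteq> {}" "A \<noteq> UNIV" and \<psi>: "\<And>x. \<psi> $ x = \<alpha> x * \<beta> x"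
    and inv: "\<And>j x. j \<notin> A \<Longrightarrow> \<alpha> (flip j x) = \<alpha> x" "\<And>i x. i \<in> A \<Longrightarrow> \<beta> (flip i x) = \<beta> x"
    and norm: "(\<Sum>x\<in>UNIV. (cmod (\<alpha> x * \<beta> x))\<^sup>2) = 1"
    by (rule pure_biseparable_factors[OF assms(2)]) (rule that)
  obtain e i j where e: "e \<in> E" "i \<in> e" "j \<in> e" and ij: "i \<in> A" "j \<notin> A"
    by (rule connected_crossing_edge[OF assms(1) A]) (rule that)
  then have "i \<noteq> j" by auto
  \<comment> \<open>The crossing edge has two distinct vertices, which secures the hypothesis
    \<open>2 \<le> k\<close> of \<open>overlap_bound\<close>.\<close>
  have "card {i, j} \<le> card e"
    using e by (intro card_mono) auto
  then have "2 \<le> max_edge_card E"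
    using \<open>i \<noteq> j\<close> card_le_max_edge_card[OF e(1)] by simp
  then show "(cmod (\<Sum>x\<in>UNIV. phase E x * \<psi> $ x))\<^sup>2
      \<le> 2 ^ CARD('n) * (1 - 1 / 2 ^ (max_edge_card E - 1))"
    unfolding \<psi>
    by (intro overlap_bound[OF e \<open>i \<noteq> j\<close>] card_le_max_edge_card inv ij norm)
  show "(\<Sum>x\<in>UNIV. (cmod (\<psi> $ x))\<^sup>2) = 1"
    using norm by (simp add: \<psi>)
qed


subsection \<open>Matrix elements of the witness\<close>

lemma CZ_prod_nth: "CZ_prod E $ x $ y = (if x = y then phase E x else 0)"
proof -
  have "finite E \<Longrightarrow> CZ_prod E $ x $ y = (if x = y then phase E x else 0)"
    by (induction E rule: finite_induct)
      (auto simp: CZ_prod_insert CZ_mult_nth phase_def mat_def)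
  then show ?thesis by simp
qed

lemma hypergraph_state_nth:
  fixes E :: "'n::finite set set"
  shows "hypergraph_state E $ x = phase E x * (1 / complex_of_real (sqrt 2)) ^ CARD('n)"
proof -
  have "ket_plus $ b = 1 / complex_of_real (sqrt 2)" for b
    by (cases b) (auto simp: ket_plus_def axis_def)
  then show ?thesis
    by (simp add: hypergraph_state_def matrix_vector_mult_def CZ_prod_nth tensor_state_def
        if_distrib[of "\<lambda>z. z * _"] cong: if_cong)
qed

lemma single_qubit_pauli_x_nth:
  "single_qubit_op i pauli_x $ x $ y = (if y = flip i x then 1 else 0)"
proof (cases "y = flip i x")
  case True
  then show ?thesis
    by (auto simp: single_qubit_op_def tensor_op_def pauli_x_def mat_def flip_def intro!: prod.neutral)
next
  case False
  then obtain j where "y j \<noteq> flip i x j" by auto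
  then have "(if j = i then pauli_x else mat 1) $ x j $ y j = 0"
    by (auto simp: pauli_x_def mat_def flip_def split: if_splits)
  then have "single_qubit_op i pauli_x $ x $ y = 0"
    unfolding single_qubit_op_def tensor_op_def vec_lambda_beta
    by (intro prod_zero bexI[of _ j]) auto
  then show ?thesis using False by simp
qed

lemma stabilizer_op_neighbourhood_nth:
  "stabilizer_op E i $ x $ y = (if y = flip i x then phase (neighbourhood E i) y else 0)"
proof -
  have "stabilizer_op E i $ x $ y
      = (\<Sum>z\<in>UNIV. if z = y then (if y = flip i x then phase (neighbourhood E i) y else 0) else 0)"
    unfolding stabilizer_op_def matrix_matrix_mult_def vec_lambda_beta
    by (rule sum.cong) (auto simp: single_qubit_pauli_x_nth CZ_prod_nth)
  then show ?thesis by simp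
qed

text \<open>Exhibits the stabilizer as the bit flip conjugated by the diagonal signs of
  \<open>E\<close>.\<close>

lemma stabilizer_op_nth:
  "stabilizer_op E i $ x $ y = (if y = flip i x then phase E x * phase E y else 0)"
  by (simp add: stabilizer_op_neighbourhood_nth phase_neighbourhood mult.commute)

definition identity_coeff :: "'n::finite set set \<Rightarrow> real" where
  "identity_coeff E = (real CARD('n) * 2 ^ (max_edge_card E - 1) - 2) / 2 ^ (max_edge_card E - 1)"

lemma identity_coeff_eq:
  fixes E :: "'n::finite set set"
  shows "identity_coeff E = real CARD('n) - 2 / 2 ^ (max_edge_card E - 1)"
  by (simp add: identity_coeff_def field_simps)

lemma stabilizer_witness_nth:
  "stabilizer_witness E $ x $ y = (if x = y then complex_of_real (identity_coeff E) else 0)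
     - (\<Sum>i\<in>UNIV. if y = flip i x then phase E x * phase E y else 0)"
  unfolding stabilizer_witness_def identity_coeff_def[symmetric]
  by (simp add: stabilizer_op_nth mat_def scaleR_conv_of_real[where 'a = complex])

lemma hermitian_stabilizer_witness: "hermitian (stabilizer_witness E)"
proof -
  have "x = flip i y \<longleftrightarrow> y = flip i x" for i and x y :: "'a \<Rightarrow> bool" by auto
  then show ?thesis
    by (simp add: hermitian_def stabilizer_witness_nth mult.commute if_distrib[of cnj] eq_commute[of "_ :: _ \<Rightarrow> bool"] cong: if_cong)
qed

lemma trace_mult_projector:
  "trace (W ** projector \<psi>) = (\<Sum>x\<in>UNIV. \<Sum>y\<in>UNIV. cnj (\<psi> $ x) * (W $ x $ y * \<psi> $ y))"
  by (simp add: trace_def matrix_matrix_mult_def projector_def mult_ac)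

text \<open>Reindexing by the flip shows that the correlation equals its own conjugate, so it is
  real; expanding the squares in \<open>energy\<close> then determines it.\<close>

lemma sum_cnj_flip:
  "(\<Sum>x\<in>UNIV. cnj (f x) * f (flip i x))
     = complex_of_real ((\<Sum>x\<in>UNIV. (cmod (f x))\<^sup>2) - energy i f / 2)"
proof -
  let ?C = "\<Sum>x\<in>UNIV. cnj (f x) * f (flip i x)"
  have "cnj ?C = ?C"
    using sum_flip[of "\<lambda>x. cnj (f x) * f (flip i x)" i] by (simp add: mult.commute)
  moreover have "complex_of_real (energy i f) = 2 * complex_of_real (\<Sum>x\<in>UNIV. (cmod (f x))\<^sup>2) - ?C - cnj ?C"
    using sum_flip[of "\<lambda>x. f x * cnj (f x)" i]
    by (simp add: energy_def complex_norm_square algebra_simps sum.distrib sum_subtractf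
        del: of_real_power)
  ultimately show ?thesis by (simp add: diff_divide_distrib)
qed

text \<open>Absorbing the signs into the state makes each stabilizer expectation a flip correlation,
  so the witness becomes a sum of energies to which \<open>poincare\<close> applies.\<close>

lemma trace_stabilizer_witness_projector:
  fixes E :: "'n::finite set set"
  shows "trace (stabilizer_witness E ** projector \<psi>) = complex_of_real
    ((identity_coeff E - real CARD('n)) * (\<Sum>x\<in>UNIV. (cmod (\<psi> $ x))\<^sup>2)
      + (\<Sum>i\<in>UNIV. energy i (\<lambda>x. phase E x * \<psi> $ x)) / 2)"
proof -
  let ?\<phi> = "\<lambda>x. phase E x * \<psi> $ x"
  have inner: "(\<Sum>y\<in>UNIV. cnj (\<psi> $ x) * (stabilizer_witness E $ x $ y * \<psi> $ y))
      = of_real (identity_coeff E) * (of_real (cmod (\<psi> $ x)))\<^sup>2 - (\<Sum>i\<in>UNIV. cnj (?\<phi> x) * ?\<phi> (flip i x))" for x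
  proof -
    have "(\<Sum>y\<in>UNIV. cnj (\<psi> $ x) * (stabilizer_witness E $ x $ y * \<psi> $ y))
       = (\<Sum>y\<in>UNIV. (if x = y then of_real (identity_coeff E) * (\<psi> $ x * cnj (\<psi> $ x)) else 0)
           - (\<Sum>i\<in>UNIV. if y = flip i x then cnj (?\<phi> x) * ?\<phi> y else 0))"
      by (intro sum.cong refl)
        (auto simp: stabilizer_witness_nth algebra_simps sum_distrib_left sum_distrib_right intro!: sum.cong)
    also have "\<dots> = of_real (identity_coeff E) * (\<psi> $ x * cnj (\<psi> $ x))
        - (\<Sum>i\<in>UNIV. \<Sum>y\<in>UNIV. if y = flip i x then cnj (?\<phi> x) * ?\<phi> y else 0)"
      by (simp only: sum_subtractf sum.swap[of _ "UNIV :: 'n set"]) simp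
    finally show ?thesis by (simp flip: complex_norm_square)
  qed
  have "trace (stabilizer_witness E ** projector \<psi>)
      = of_real (identity_coeff E) * of_real (\<Sum>x\<in>UNIV. (cmod (\<psi> $ x))\<^sup>2)
        - (\<Sum>i\<in>UNIV. \<Sum>x\<in>UNIV. cnj (?\<phi> x) * ?\<phi> (flip i x))"
    unfolding trace_mult_projector inner sum_subtractf sum.swap[of _ "UNIV :: 'n set"]
    by (simp add: sum_distrib_left)
  moreover have "(\<Sum>x\<in>UNIV. cnj (?\<phi> x) * ?\<phi> (flip i x))
      = of_real ((\<Sum>x\<in>UNIV. (cmod (\<psi> $ x))\<^sup>2) - energy i ?\<phi> / 2)" for i
    unfolding sum_cnj_flip[of ?\<phi> i] by (simp only: norm_mult cmod_phase mult_1)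
  ultimately show ?thesis
    by (simp only: sum_subtractf flip: of_real_mult of_real_diff of_real_sum)
      (simp add: left_diff_distrib sum_divide_distrib)
qed

lemma trace_stabilizer_witness:
  fixes E :: "'n::finite set set"
  shows "trace (stabilizer_witness E) = complex_of_real (identity_coeff E * 2 ^ CARD('n))"
  by (simp add: trace_def stabilizer_witness_nth card_fun)

lemma sum_cmod_hypergraph_state: "(\<Sum>x\<in>UNIV. (cmod (hypergraph_state E $ x))\<^sup>2) = 1"
proof -
  have "(cmod (hypergraph_state E $ x))\<^sup>2 = (1 / 2) ^ CARD('a)" for x
    by (simp add: hypergraph_state_nth norm_mult norm_power norm_divide power_divide
        flip: power_mult power_mult_distrib) (simp add: power_mult power_mult_distrib mult.commute[of _ 2])
  then show ?thesis by (simp add: card_fun power_divide)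
qed

text \<open>The signs cancel against those of the state, leaving a constant function with zero
  energies.\<close>

lemma trace_witness_hypergraph_state:
  "trace (stabilizer_witness E ** projector (hypergraph_state E))
     = complex_of_real (- (2 / 2 ^ (max_edge_card E - 1)))"
  unfolding trace_stabilizer_witness_projector sum_cmod_hypergraph_state
  by (simp add: identity_coeff_eq hypergraph_state_nth energy_def)

section \<open>Pure density matrices and positivity on biseparable mixtures\<close>

lemma density_matrix_projector:
  assumes "(\<Sum>x\<in>UNIV. (cmod (\<psi> $ x))\<^sup>2) = 1"
  shows "density_matrix (projector \<psi>)"
proof -
  have "(\<Sum>x\<in>UNIV. cnj (v $ x) * (projector \<psi> *v v) $ x)
      = complex_of_real ((cmod (\<Sum>x\<in>UNIV. cnj (v $ x) * \<psi> $ x))\<^sup>2)" for v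
    unfolding complex_norm_square
    by (simp add: projector_def matrix_vector_mult_def sum_product sum_distrib_left mult_ac)
      (rule sum.swap)
  then have "pos_semidef (projector \<psi>)"
    by (auto simp: pos_semidef_def hermitian_def projector_def less_eq_complex_def)
  moreover have "trace (projector \<psi>) = complex_of_real (\<Sum>x\<in>UNIV. (cmod (\<psi> $ x))\<^sup>2)"
    unfolding of_real_sum complex_norm_square by (simp add: trace_def projector_def)
  ultimately show ?thesis using assms by (simp add: density_matrix_def)
qed

lemma trace_scaleR: "trace (r *\<^sub>R A) = r *\<^sub>R trace (A :: complex^'a::finite^'a)"
  by (simp add: trace_def scaleR_sum_right)

text \<open>The condition on \<open>\<rho>\<close> is convex, so it suffices to check pure
  biseparable states.\<close>

lemma trace_witness_nonneg:
  assumes "connected_hypergraph E" "\<rho> \<in> S_bi"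
  shows "0 \<le> trace (stabilizer_witness E ** \<rho>)"
proof -
  let ?T = "{\<rho>. 0 \<le> trace (stabilizer_witness E ** \<rho>)}"
  have "projector ` {\<psi>. pure_biseparable \<psi>} \<subseteq> ?T"
  proof clarify
    fix \<psi> :: "'a state" assume \<psi>: "pure_biseparable \<psi>"
    let ?\<phi> = "\<lambda>x. phase E x * \<psi> $ x"
    note bound = biseparable_overlap_bound[OF assms(1) \<psi>]
    have "(cmod (\<Sum>x\<in>UNIV. ?\<phi> x))\<^sup>2 / 2 ^ CARD('a) \<le> 1 - 1 / 2 ^ (max_edge_card E - 1)"
      using bound(1) by (simp add: divide_le_eq mult.commute)
    moreover have "(\<Sum>x\<in>UNIV. (cmod (?\<phi> x))\<^sup>2) = 1"
      using bound(2) by (simp add: norm_mult)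
    \<comment> \<open>The overlap bound caps the weight on the uniform state, and Poincare turns the
      missing weight into energy. Twice this inequality offsets the negative term
      \<open>identity_coeff E - n\<close>.\<close>
    ultimately have "1 / 2 ^ (max_edge_card E - 1) \<le> (\<Sum>i\<in>UNIV. energy i ?\<phi>) / 4"
      using poincare[of ?\<phi>] by linarith
    then have "0 \<le> (identity_coeff E - real CARD('a)) * (\<Sum>x\<in>UNIV. (cmod (\<psi> $ x))\<^sup>2)
        + (\<Sum>i\<in>UNIV. energy i ?\<phi>) / 2"
      unfolding bound(2) identity_coeff_eq by simp
    then show "0 \<le> trace (stabilizer_witness E ** projector \<psi>)"
      unfolding trace_stabilizer_witness_projector by (simp add: less_eq_complex_def)
  qed
  moreover have "convex ?T"
    unfolding convex_def
    by (auto simp: matrix_add_ldistrib trace_add matrix_scalar_ac trace_scaleR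
        scalar_matrix_assoc[symmetric]
        less_eq_complex_def)
  ultimately show ?thesis
    using assms(2) hull_minimal[of _ ?T convex] unfolding S_bi_def by blast
qed

section \<open>White noise and the robustness threshold\<close>

lemma matrix_matrix_add_rdistrib: "(A + B) ** C = A ** C + B ** C"
  by (simp add: matrix_matrix_mult_def vec_eq_iff sum.distrib distrib_right)

lemma trace_noisy_state:
  fixes \<psi> :: "'n::finite state"
  shows "trace (noisy_state \<psi> p ** W)
    = complex_of_real (p / 2 ^ CARD('n)) * trace W + complex_of_real (1 - p) * trace (W ** projector \<psi>)"
proof -
  have "noisy_state \<psi> p ** W = (p / 2 ^ CARD('n)) *\<^sub>R W + (1 - p) *\<^sub>R (projector \<psi> ** W)"
    by (simp add: noisy_state_def matrix_matrix_add_rdistrib scalar_matrix_assoc[symmetric])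
  then show ?thesis
    by (simp only: trace_add trace_scaleR trace_mul_sym[of "projector \<psi>"] scaleR_conv_of_real[where 'a = complex])
qed

lemma trace_noisy_hypergraph_state:
  fixes E :: "'n::finite set set"
  shows "trace (noisy_state (hypergraph_state E) p ** stabilizer_witness E)
    = complex_of_real (p * real CARD('n) - 2 / 2 ^ (max_edge_card E - 1))"
proof -
  have "trace (noisy_state (hypergraph_state E) p ** stabilizer_witness E)
    = complex_of_real (p / 2 ^ CARD('n) * (identity_coeff E * 2 ^ CARD('n))
        + (1 - p) * (- (2 / 2 ^ (max_edge_card E - 1))))"
    unfolding trace_noisy_state trace_stabilizer_witness trace_witness_hypergraph_state by simp
  also have "p / 2 ^ CARD('n) * (identity_coeff E * 2 ^ CARD('n))
        + (1 - p) * (- (2 / 2 ^ (max_edge_card E - 1)))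
      = p * real CARD('n) - 2 / 2 ^ (max_edge_card E - 1)"
    by (simp add: identity_coeff_eq field_simps)
  finally show ?thesis .
qed

lemma robustness_parameter_witness:
  fixes E :: "'n::finite set set"
  assumes "CARD('n) \<ge> 2"
  shows "is_robustness_parameter (stabilizer_witness E) (hypergraph_state E)
           (2 / (real CARD('n) * 2 ^ (max_edge_card E - 1)))"
proof -
  let ?k = "(2::real) ^ (max_edge_card E - 1)"
  let ?q = "2 / (real CARD('n) * ?k)"
  have iff: "trace (noisy_state (hypergraph_state E) p ** stabilizer_witness E) < 0 \<longleftrightarrow> p < ?q" for p
    using assms unfolding trace_noisy_hypergraph_state
    by (simp add: less_complex_def field_simps)
  \<comment> \<open>The threshold must lie in the unit interval to be admissible in
    \<open>detects_below\<close>.\<close>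
  have "2 * 1 \<le> real CARD('n) * ?k"
    using assms by (intro mult_mono) auto
  then have "?q \<le> 1" by simp
  \<comment> \<open>For maximality, any larger \<open>q'\<close> would admit \<open>p = ?q\<close>,
    where the trace is not negative.\<close>
  then show ?thesis
    unfolding is_robustness_parameter_def detects_below_def iff
    by (smt (verit) divide_nonneg_nonneg mult_nonneg_nonneg of_nat_0_le_iff zero_le_power)
qed


subsection \<open>Measurement settings\<close>

definition pauli_z :: qubit_op where
  "pauli_z = (\<chi> a b. if a = b then (if a then -1 else 1) else 0)"

definition xz_setting :: "'n \<Rightarrow> 'n \<Rightarrow> qubit_op" where
  "xz_setting i j = (if j = i then pauli_x else pauli_z)"

text \<open>The linear span of what a single setting measures, so that closure properties can be
  proved setting by setting.\<close>

definition accessible :: "('n \<Rightarrow> qubit_op) \<Rightarrow> 'n::finite operator \<Rightarrow> bool" where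
  "accessible M T \<longleftrightarrow> (\<exists>c. T = (\<Sum>A\<in>UNIV. map_matrix (\<lambda>z. c A * z) (setting_product M A)))"

lemma measurement_setting_xz: "measurement_setting (xz_setting i)"
  by (auto simp: measurement_setting_def xz_setting_def hermitian_def pauli_x_def pauli_z_def)

text \<open>Allows a sum over qubits to be rewritten as a sum over the set of settings.\<close>

lemma inj_xz_setting: "inj xz_setting"
proof (rule injI)
  fix i j :: 'a assume "xz_setting i = xz_setting j"
  then have "xz_setting i i $ True $ False = xz_setting j i $ True $ False" by simp
  then show "i = j" by (auto simp: xz_setting_def pauli_x_def pauli_z_def split: if_splits)
qed

lemma map_matrix_nth: "map_matrix f A $ x $ y = f (A $ x $ y)"
  by (simp add: map_matrix_def)

lemma accessible_add:
  assumes "accessible M S" "accessible M T"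
  shows "accessible M (S + T)"
proof -
  obtain c d where "S = (\<Sum>A\<in>UNIV. map_matrix (\<lambda>z. c A * z) (setting_product M A))"
    "T = (\<Sum>A\<in>UNIV. map_matrix (\<lambda>z. d A * z) (setting_product M A))"
    using assms unfolding accessible_def by blast
  then have "S + T = (\<Sum>A\<in>UNIV. map_matrix (\<lambda>z. (c A + d A) * z) (setting_product M A))"
    by (simp add: vec_eq_iff map_matrix_nth sum.distrib distrib_right)
  then show ?thesis unfolding accessible_def by (rule exI[of _ "\<lambda>A. c A + d A"])
qed

lemma accessible_scale:
  assumes "accessible M T"
  shows "accessible M (map_matrix (\<lambda>z. r * z) T)"
proof -
  obtain c where "T = (\<Sum>A\<in>UNIV. map_matrix (\<lambda>z. c A * z) (setting_product M A))"
    using assms unfolding accessible_def by blast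
  then have "map_matrix (\<lambda>z. r * z) T
      = (\<Sum>A\<in>UNIV. map_matrix (\<lambda>z. (r * c A) * z) (setting_product M A))"
    by (simp add: vec_eq_iff map_matrix_nth sum_distrib_left mult.assoc)
  then show ?thesis unfolding accessible_def by (rule exI[of _ "\<lambda>A. r * c A"])
qed

lemma accessible_sum:
  assumes "finite I" "I \<noteq> {}" "\<And>w. w \<in> I \<Longrightarrow> accessible M (T w)"
  shows "accessible M (\<Sum>w\<in>I. T w)"
  using assms by (induction rule: finite_ne_induct) (auto intro: accessible_add)

text \<open>Expand the product of the sums \<open>\<beta> j M j + \<alpha> j 1\<close>: a subset
  \<open>A\<close> records the factors from which \<open>M\<close> is chosen.\<close>

lemma accessible_tensor_op:
  fixes M :: "'n::finite \<Rightarrow> qubit_op"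
  assumes "\<And>j p q. B j $ p $ q = \<beta> j * M j $ p $ q + \<alpha> j * mat 1 $ p $ q"
  shows "accessible M (tensor_op B)"
proof -
  have "tensor_op B $ x $ y = (\<Sum>A\<in>UNIV. (prod \<beta> A * prod \<alpha> (UNIV - A)) * setting_product M A $ x $ y)" for x y
  proof -
    have "setting_product M A $ x $ y
        = (\<Prod>j\<in>A. M j $ x j $ y j) * (\<Prod>j\<in>UNIV - A. mat 1 $ x j $ y j)" for A
    proof -
      have "setting_product M A $ x $ y
          = (\<Prod>j\<in>A \<union> (UNIV - A). (if j \<in> A then M j else mat 1) $ x j $ y j)"
        by (simp add: setting_product_def tensor_op_def)
      also have "\<dots> = (\<Prod>j\<in>A. M j $ x j $ y j) * (\<Prod>j\<in>UNIV - A. mat 1 $ x j $ y j)"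
        by (subst prod.union_disjoint) auto
      finally show ?thesis .
    qed
    then show ?thesis
      by (simp add: tensor_op_def assms prod_add[OF finite] prod.distrib mult_ac)
  qed
  then have "tensor_op B = (\<Sum>A\<in>UNIV. map_matrix (\<lambda>z. (prod \<beta> A * prod \<alpha> (UNIV - A)) * z) (setting_product M A))"
    by (simp add: vec_eq_iff map_matrix_nth)
  then show ?thesis unfolding accessible_def by (rule exI[of _ "\<lambda>A. prod \<beta> A * prod \<alpha> (UNIV - A)"])
qed

definition basis_block :: "'n \<Rightarrow> ('n \<Rightarrow> bool) \<Rightarrow> 'n \<Rightarrow> qubit_op" where
  "basis_block i w j = (if j = i then pauli_x else \<chi> p q. if p = w j \<and> q = w j then 1 else 0)"

text \<open>Since \<open>(1 \<plusminus> Z) / 2\<close> are the projectors onto the basis states of one qubit, \<open>X\<close> on qubit \<open>i\<close>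
  times an arbitrary diagonal operator on the others is accessible from \<open>xz_setting i\<close>.\<close>

lemma accessible_basis_block: "accessible (xz_setting i) (tensor_op (basis_block i w))"
  by (rule accessible_tensor_op[where \<beta> = "\<lambda>j. if j = i then 1 else if w j then -1/2 else 1/2"
        and \<alpha> = "\<lambda>j. if j = i then 0 else 1/2"])
    (auto simp: basis_block_def xz_setting_def pauli_z_def mat_def)

lemma tensor_op_basis_block_nth:
  "tensor_op (basis_block i w) $ x $ y
     = (if y = flip i x \<and> (w = x \<or> w = flip i x) then 1 else 0)"
proof (cases "y = flip i x \<and> (w = x \<or> w = flip i x)")
  case True
  then have "basis_block i w j $ x j $ y j = 1" for j
    by (cases "j = i") (auto simp: basis_block_def pauli_x_def flip_def)
  then show ?thesis using True by (simp add: tensor_op_def)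
next
  case False
  have "\<exists>j. basis_block i w j $ x j $ y j = 0"
  proof (rule ccontr)
    assume "\<nexists>j. basis_block i w j $ x j $ y j = 0"
    then have "(if j = i then x j \<noteq> y j else x j = w j \<and> y j = w j)" for j
      by (auto simp: basis_block_def pauli_x_def split: if_splits)
    then have *: "x i \<noteq> y i" "\<And>j. j \<noteq> i \<Longrightarrow> x j = w j \<and> y j = w j"
      by (metis, metis)
    have "y = flip i x" using * by (auto simp: flip_def fun_eq_iff)
    moreover have "w j = (if w i = x i then x j else flip i x j)" for j
      using * by (cases "j = i") (auto simp: flip_def)
    then have "w = x \<or> w = flip i x" by (cases "w i = x i") (auto simp: fun_eq_iff)
    ultimately show False using False by simp
  qed
  then have "tensor_op (basis_block i w) $ x $ y = 0"
    unfolding tensor_op_def vec_lambda_beta by (auto intro: prod_zero)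
  then show ?thesis unfolding if_not_P[OF False] .
qed

lemma accessible_stabilizer_op: "accessible (xz_setting i) (stabilizer_op E i)"
proof -
  \<comment> \<open>The strings \<open>w\<close> and \<open>flip i w\<close> yield the same block;
    the guard \<open>w i\<close> keeps one of each pair, avoiding double counting.\<close>
  let ?d = "\<lambda>w. if w i then phase (neighbourhood E i) w else 0"
  let ?S = "\<Sum>w\<in>UNIV. map_matrix (\<lambda>z. ?d w * z) (tensor_op (basis_block i w))"
  have "?S $ x $ y = stabilizer_op E i $ x $ y" for x y
  proof -
    have "?S $ x $ y = (\<Sum>w\<in>UNIV. if y = flip i x \<and> (w = x \<or> w = flip i x) then ?d w else 0)"
      by (auto simp: map_matrix_nth tensor_op_basis_block_nth intro!: sum.cong)
    also have "\<dots> = (\<Sum>w\<in>UNIV. if w = x(i := True) then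
        (if y = flip i x then phase (neighbourhood E i) y else 0) else 0)"
    proof (intro sum.cong refl)
      fix w
      \<comment> \<open>Neighbourhood signs do not see bit \<open>i\<close>, so evaluating them at
        \<open>w\<close> or at \<open>y\<close> gives the same value.\<close>
      have p: "phase (neighbourhood E i) (flip i x) = phase (neighbourhood E i) x"
        by (simp add: phase_neighbourhood mult.commute)
      have w: "w = x(i := True) \<longleftrightarrow> w i \<and> (w = x \<or> w = flip i x)"
        by (cases "x i") (auto simp: flip_def fun_eq_iff)
      show "(if y = flip i x \<and> (w = x \<or> w = flip i x) then ?d w else 0)
          = (if w = x(i := True) then (if y = flip i x then phase (neighbourhood E i) y else 0) else 0)"
        unfolding w by (auto simp: p)
    qed
    finally show ?thesis by (simp add: stabilizer_op_neighbourhood_nth)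
  qed
  then have "stabilizer_op E i = ?S" by (simp add: vec_eq_iff)
  then show ?thesis by (auto intro!: accessible_sum accessible_scale accessible_basis_block)
qed

lemma accessible_mat_1: "accessible M (mat 1)"
proof -
  have "(\<Prod>j\<in>UNIV. (mat 1 :: qubit_op) $ x j $ y j) = mat 1 $ x $ y" for x y :: "'a \<Rightarrow> bool"
  proof (cases "x = y")
    case False
    then obtain j where "x j \<noteq> y j" by auto
    then have "(\<Prod>j\<in>UNIV. (mat 1 :: qubit_op) $ x j $ y j) = 0"
      by (intro prod_zero bexI[of _ j]) (auto simp: mat_def)
    then show ?thesis using False by (simp add: mat_def)
  qed (simp add: mat_def)
  then have "mat 1 = tensor_op (\<lambda>j :: 'a. mat 1 :: qubit_op)"
    by (simp add: vec_eq_iff tensor_op_def)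
  then show ?thesis
    using accessible_tensor_op[of "\<lambda>_. mat 1" "\<lambda>_. 0" M "\<lambda>_. 1"] by simp
qed

lemma measured_by_stabilizer_witness:
  fixes E :: "'n::finite set set"
  shows "measured_by (range xz_setting) (stabilizer_witness E)"
proof -
  \<comment> \<open>The identity term is shared evenly among the \<open>n\<close> stabilizer
    settings, so it costs no additional one.\<close>
  define r where "r = complex_of_real (identity_coeff E / real CARD('n))"
  define T where "T i = map_matrix (\<lambda>z. r * z) (mat 1) + map_matrix (\<lambda>z. - 1 * z) (stabilizer_op E i)" for i
  have "accessible (xz_setting i) (T i)" for i
    unfolding T_def by (intro accessible_add accessible_scale accessible_mat_1 accessible_stabilizer_op)
  then have "\<forall>i. \<exists>c. T i = (\<Sum>A\<in>UNIV. map_matrix (\<lambda>z. c A * z) (setting_product (xz_setting i) A))"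
    unfolding accessible_def by blast
  then obtain c where c: "T i = (\<Sum>A\<in>UNIV. map_matrix (\<lambda>z. c i A * z) (setting_product (xz_setting i) A))" for i
    by metis
  have T: "T i $ x $ y = (if x = y then r else 0) - (if y = flip i x then phase E x * phase E y else 0)"
    for i x y
    by (simp add: T_def map_matrix_nth mat_def stabilizer_op_nth)
  have "stabilizer_witness E $ x $ y = (\<Sum>i\<in>UNIV. T i $ x $ y)" for x y
    by (simp add: T stabilizer_witness_nth sum_subtractf r_def)
  then have "stabilizer_witness E = (\<Sum>i\<in>UNIV. T i)"
    by (simp add: vec_eq_iff)
  \<comment> \<open>Coefficients in \<open>measured_by\<close> are indexed by settings; injectivity
    recovers the qubit from its setting.\<close>
  also have "\<dots> = (\<Sum>i\<in>UNIV. \<Sum>A\<in>UNIV. map_matrix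
      (\<lambda>z. c (inv xz_setting (xz_setting i)) A * z) (setting_product (xz_setting i) A))"
    by (simp add: c inv_f_f[OF inj_xz_setting])
  also have "\<dots> = (\<Sum>M\<in>range xz_setting. \<Sum>A\<in>UNIV. map_matrix
      (\<lambda>z. c (inv xz_setting M) A * z) (setting_product M A))"
    by (simp add: sum.reindex[OF inj_xz_setting])
  finally show ?thesis
    unfolding measured_by_def
    by (intro conjI exI[of _ "\<lambda>M. c (inv xz_setting M)"]) (auto simp: measurement_setting_xz)
qed

theorem mainTheorem5:
  fixes E :: "'n::finite set set"
  assumes "CARD('n) \<ge> 2"
    and "hypergraph E"
    and "connected_hypergraph E"
  shows "entanglement_witness (stabilizer_witness E) \<and>
         trace (stabilizer_witness E ** projector (hypergraph_state E)) < 0 \<and>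
         is_robustness_parameter (stabilizer_witness E) (hypergraph_state E)
           (2 / (real CARD('n) * 2 ^ (max_edge_card E - 1))) \<and>
         (\<exists>\<M>. card \<M> \<le> CARD('n) \<and> measured_by \<M> (stabilizer_witness E))"
proof -
  let ?W = "stabilizer_witness E" and ?P = "projector (hypergraph_state E)"
  have neg: "trace (?W ** ?P) < 0"
    unfolding trace_witness_hypergraph_state by (simp add: less_complex_def)
  \<comment> \<open>A biseparable \<open>?P\<close> would have nonnegative trace against the
    witness, contradicting \<open>neg\<close>.\<close>
  have "completely_entangled ?P"
    using trace_witness_nonneg[OF assms(3), of ?P] neg
      density_matrix_projector[OF sum_cmod_hypergraph_state]
    by (auto simp: completely_entangled_def)
  then have "entanglement_witness ?W"
    using hermitian_stabilizer_witness trace_witness_nonneg[OF assms(3)] neg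
    unfolding entanglement_witness_def by blast
  moreover have "card (range (xz_setting :: 'n \<Rightarrow> _)) \<le> CARD('n)"
    by (rule card_image_le) simp
  ultimately show ?thesis
    using neg robustness_parameter_witness[OF assms(1)] measured_by_stabilizer_witness by blast
qed

end
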